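(* Let $S$ be a set and let $Q$ be a set of functions $S\to[0,1]$ containing the constant functions $0$ and $1$ and closed under the operations $\oplus$ and $\odot$ defined by $$(p\oplus q)(s):=\max\big(p(s),q(s)\big)-\min\big(p(s),q(s)\big),\qquad (p\odot q)(s):=\min\big(p(s),q(s)\big)$$ for all $s\in S$. Let $\mathbf Q=(Q,\oplus,\odot,0,1)$. Then the following hold: (i) $\mathbf Q$ is a specific near-RLSE; (ii) $\mathbf Q$ is a generalized field of events (GFE) with respect to the pointwise order $\leq$ of functions; (iii) the following are equivalent: (a) $Q\subseteq\{0,1\}^S$; (b) $\mathbf Q$ satisfies identity (R3); (c) $\mathbf Q$ satisfies identity (R4); (d) $\mathbf Q$ is an RLSE; (e) $\mathbf Q$ is a Boolean ring.
   Context: Consider algebras $(R,+,\cdot,0,1)$ of type $(2,2,0,0)$ and the following identities (multiplication binds more strongly than addition): (R1) $x+y=y+x$; (R2) $(xy+1)(x+1)+1=x$; (R3) $\big((xy+1)x+1\big)x=xy$; (R4) $xy+(x+1)=(xy+1)x+1$; (R5) $x+y=x(y+1)+(x+1)y$. A ring-like structure of events (RLSE) is such an algebra for which $(R,\cdot,0,1)$ is a bounded meet-semilattice (i.e. $\cdot$ is associative, commutative and idempotent, $x0=0$ and $x1=x$ for all $x$) and (R1)–(R4) hold. A near-RLSE is such an algebra for which $(R,\cdot,0,1)$ is a bounded meet-semilattice and (R1) and (R2) hold; it is called specific if it also satisfies (R5). For $\mathbf Q$, the roles of $+$ and $\cdot$ are played by $\oplus$ and $\odot$. A generalized field of events (GFE)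 is a set $P$ of functions $S\to[0,1]$ such that $0,1\in P$; $1-p\in P$ for every $p\in P$; and whenever $p,q\in P$ satisfy $p\leq 1-q$ (pointwise), the pointwise sum $p+q$ belongs to $P$. A Boolean ring is a ring with unit in which every element is idempotent under multiplication. *)

theory Defs
  imports Complex_Main "HOL-Library.FuncSet" "HOL-Algebra.Ring"
begin

text \<open>
  Algebras $(R,+,\cdot,0,1)$ of type $(2,2,0,0)$ are represented by the \<open>ring\<close> record of HOL-Algebra,
  which by itself imposes no axioms. That the operations and constants stay inside
  the carrier is therefore an explicit assumption.
\<close>

locale algebra_2200 =
  fixes R (structure)
  assumes add_in: "\<lbrakk>x \<in> carrier R; y \<in> carrier R\<rbrakk> \<Longrightarrow> x \<oplus> y \<in> carrier R"
    and mult_in: "\<lbrakk>x \<in> carrier R; y \<in> carrier R\<rbrakk> \<Longrightarrow> x \<otimes> y \<in> carrier R"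
    and zero_in: "\<zero> \<in> carrier R"
    and one_in: "\<one> \<in> carrier R"

locale bounded_meet_semilattice = algebra_2200 R for R (structure) +
  assumes meet_assoc: "\<lbrakk>x \<in> carrier R; y \<in> carrier R; z \<in> carrier R\<rbrakk>
      \<Longrightarrow> (x \<otimes> y) \<otimes> z = x \<otimes> (y \<otimes> z)"
    and meet_comm: "\<lbrakk>x \<in> carrier R; y \<in> carrier R\<rbrakk> \<Longrightarrow> x \<otimes> y = y \<otimes> x"
    and meet_idem: "x \<in> carrier R \<Longrightarrow> x \<otimes> x = x"
    and meet_zero: "x \<in> carrier R \<Longrightarrow> x \<otimes> \<zero> = \<zero>"
    and meet_one: "x \<in> carrier R \<Longrightarrow> x \<otimes> \<one> = x"

locale identity_R1 =
  fixes R (structure)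
  assumes R1: "\<lbrakk>x \<in> carrier R; y \<in> carrier R\<rbrakk> \<Longrightarrow> x \<oplus> y = y \<oplus> x"

locale identity_R2 =
  fixes R (structure)
  assumes R2: "\<lbrakk>x \<in> carrier R; y \<in> carrier R\<rbrakk>
      \<Longrightarrow> (x \<otimes> y \<oplus> \<one>) \<otimes> (x \<oplus> \<one>) \<oplus> \<one> = x"

locale identity_R3 =
  fixes R (structure)
  assumes R3: "\<lbrakk>x \<in> carrier R; y \<in> carrier R\<rbrakk>
      \<Longrightarrow> ((x \<otimes> y \<oplus> \<one>) \<otimes> x \<oplus> \<one>) \<otimes> x = x \<otimes> y"

locale identity_R4 =
  fixes R (structure)
  assumes R4: "\<lbrakk>x \<in> carrier R; y \<in> carrier R\<rbrakk>
      \<Longrightarrow> x \<otimes> y \<oplus> (x \<oplus> \<one>) = (x \<otimes> y \<oplus> \<one>) \<otimes> x \<oplus> \<one>"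

locale identity_R5 =
  fixes R (structure)
  assumes R5: "\<lbrakk>x \<in> carrier R; y \<in> carrier R\<rbrakk>
      \<Longrightarrow> x \<oplus> y = x \<otimes> (y \<oplus> \<one>) \<oplus> (x \<oplus> \<one>) \<otimes> y"

locale near_RLSE =
  bounded_meet_semilattice R + identity_R1 R + identity_R2 R for R (structure)

locale specific_near_RLSE = near_RLSE R + identity_R5 R for R (structure)

locale RLSE =
  bounded_meet_semilattice R + identity_R1 R + identity_R2 R + identity_R3 R + identity_R4 R
  for R (structure)

locale boolean_ring = ring R for R (structure) +
  assumes mult_idem: "x \<in> carrier R \<Longrightarrow> x \<otimes> x = x"

text \<open>
  Functions on the (possibly empty) set \<open>S\<close> are represented extensionally: they are
  \<open>undefined\<close> outside \<open>S\<close>, so that HOL equality is equality of functions on \<open>S\<close>.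
\<close>

definition GFE :: "'a set \<Rightarrow> ('a \<Rightarrow> real) set \<Rightarrow> bool" where
  "GFE S P \<longleftrightarrow>
     P \<subseteq> S \<rightarrow>\<^sub>E {0..1} \<and>
     (\<lambda>s\<in>S. 0) \<in> P \<and> (\<lambda>s\<in>S. 1) \<in> P \<and>
     (\<forall>p\<in>P. (\<lambda>s\<in>S. 1 - p s) \<in> P) \<and>
     (\<forall>p\<in>P. \<forall>q\<in>P. (\<forall>s\<in>S. p s \<le> 1 - q s) \<longrightarrow> (\<lambda>s\<in>S. p s + q s) \<in> P)"

definition fun_oplus :: "'a set \<Rightarrow> ('a \<Rightarrow> real) \<Rightarrow> ('a \<Rightarrow> real) \<Rightarrow> 'a \<Rightarrow> real" where
  "fun_oplus S p q = (\<lambda>s\<in>S. max (p s) (q s) - min (p s) (q s))"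

definition fun_odot :: "'a set \<Rightarrow> ('a \<Rightarrow> real) \<Rightarrow> ('a \<Rightarrow> real) \<Rightarrow> 'a \<Rightarrow> real" where
  "fun_odot S p q = (\<lambda>s\<in>S. min (p s) (q s))"

definition fun_algebra :: "'a set \<Rightarrow> ('a \<Rightarrow> real) set \<Rightarrow> ('a \<Rightarrow> real) ring" where
  "fun_algebra S Q =
     \<lparr>carrier = Q, mult = fun_odot S, one = (\<lambda>s\<in>S. 1), zero = (\<lambda>s\<in>S. 0), add = fun_oplus S\<rparr>"

end

theory Submission imports Defs
begin

text \<open>
  The complement is the pointwise \<open>1 - p\<close>, so all identities reduce to real numbers in \<open>[0, 1]\<close>.
  Whenever \<open>p \<le> 1 - q\<close>, one has \<open>p + q = 1 \<oplus> ((1 \<oplus> p) \<oplus> q)\<close>, which gives the GFE property.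
  Each of (R3) with \<open>y = 0\<close>, (R4) with \<open>y = 1\<close>, and the ring axioms (via \<open>x (x + 1) = x + x = 0\<close>)
  forces \<open>min (p s) (1 - p s) = 0\<close>, i.e. \<open>p s \<in> {0, 1}\<close>.
\<close>

lemma fun_oplus_apply [simp]: "s \<in> S \<Longrightarrow> fun_oplus S p q s = max (p s) (q s) - min (p s) (q s)"
  by (simp add: fun_oplus_def)

lemma fun_oplus_arb [simp]: "s \<notin> S \<Longrightarrow> fun_oplus S p q s = undefined"
  by (simp add: fun_oplus_def)

lemma fun_odot_apply [simp]: "s \<in> S \<Longrightarrow> fun_odot S p q s = min (p s) (q s)"
  by (simp add: fun_odot_def)

lemma fun_odot_arb [simp]: "s \<notin> S \<Longrightarrow> fun_odot S p q s = undefined"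
  by (simp add: fun_odot_def)

lemma fun_algebra_simps [simp]:
  "carrier (fun_algebra S Q) = Q"
  "mult (fun_algebra S Q) = fun_odot S"
  "one (fun_algebra S Q) = (\<lambda>s\<in>S. 1)"
  "zero (fun_algebra S Q) = (\<lambda>s\<in>S. 0)"
  "add (fun_algebra S Q) = fun_oplus S"
  by (simp_all add: fun_algebra_def)

text \<open>Extensionality is split at \<open>S\<close> because off \<open>S\<close> every operation
  returns \<open>undefined\<close>. That case falls to the simplifier, and what remains is an
  identity between real numbers at a single point of \<open>S\<close>.\<close>

lemma fun_eqI:
  assumes "\<And>s. s \<in> S \<Longrightarrow> f s = g s" and "\<And>s. s \<notin> S \<Longrightarrow> f s = g s"
  shows "f = g"
  using assms by blast

locale function_algebra =
  fixes S :: "'a set" and Q :: "('a \<Rightarrow> real) set"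
  assumes subset_unit: "Q \<subseteq> S \<rightarrow>\<^sub>E {0..1}"
    and zero_mem: "(\<lambda>s\<in>S. 0) \<in> Q"
    and one_mem: "(\<lambda>s\<in>S. 1) \<in> Q"
    and oplus_mem: "p \<in> Q \<Longrightarrow> q \<in> Q \<Longrightarrow> fun_oplus S p q \<in> Q"
    and odot_mem: "p \<in> Q \<Longrightarrow> q \<in> Q \<Longrightarrow> fun_odot S p q \<in> Q"
begin

lemma mem_arb [simp]: "p \<in> Q \<Longrightarrow> s \<notin> S \<Longrightarrow> p s = undefined"
  using PiE_arb[OF subsetD[OF subset_unit]] by simp

lemma mem_ge_0: "p \<in> Q \<Longrightarrow> s \<in> S \<Longrightarrow> 0 \<le> p s"
  and mem_le_1: "p \<in> Q \<Longrightarrow> s \<in> S \<Longrightarrow> p s \<le> 1"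
  using PiE_mem[OF subsetD[OF subset_unit]] by simp_all

lemma specific_near_RLSE_fun_algebra: "specific_near_RLSE (fun_algebra S Q)"
proof (unfold_locales; simp only: fun_algebra_simps)
  fix x y z assume m: "x \<in> Q" "y \<in> Q" "z \<in> Q"
  show "fun_odot S (fun_odot S x y) z = fun_odot S x (fun_odot S y z)"
    by (rule fun_eqI[of S]) (auto simp: min.assoc)
next
  fix x y assume m: "x \<in> Q" "y \<in> Q"
  note b = mem_ge_0[OF m(1)] mem_le_1[OF m(1)] mem_ge_0[OF m(2)] mem_le_1[OF m(2)]
  show "fun_oplus S x y \<in> Q" "fun_odot S x y \<in> Q"
    using m by (simp_all add: oplus_mem odot_mem)
  show "fun_odot S x y = fun_odot S y x"
    by (rule fun_eqI[of S]) (auto simp: min.commute)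
  show "fun_oplus S x y = fun_oplus S y x"
    by (rule fun_eqI[of S]) (auto simp: min.commute max.commute)
  \<comment> \<open>Since min x y \<le> x, the complement of min x y is at least 1 - x. The product
    is therefore 1 - x, and complementing it returns x.\<close>
  show "fun_oplus S (fun_odot S (fun_oplus S (fun_odot S x y) (\<lambda>s\<in>S. 1))
      (fun_oplus S x (\<lambda>s\<in>S. 1))) (\<lambda>s\<in>S. 1) = x"
  proof (rule fun_eqI[of S])
    fix s assume s: "s \<in> S"
    then show "fun_oplus S (fun_odot S (fun_oplus S (fun_odot S x y) (\<lambda>s\<in>S. 1))
        (fun_oplus S x (\<lambda>s\<in>S. 1))) (\<lambda>s\<in>S. 1) s = x s"
      using b[OF s] by (simp add: min_def max_def)
  \<comment> \<open>Here one side is \<open>x\<close> itself, so its value off \<open>S\<close> is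
    known only through membership in \<open>Q\<close>.\<close>
  qed (use m in simp)
  \<comment> \<open>If x \<le> 1 - y, then y \<le> 1 - x and the two products are x and y. Otherwise
    they are 1 - y and 1 - x, which are the same distance apart.\<close>
  show "fun_oplus S x y = fun_oplus S (fun_odot S x (fun_oplus S y (\<lambda>s\<in>S. 1)))
      (fun_odot S (fun_oplus S x (\<lambda>s\<in>S. 1)) y)"
  proof (rule fun_eqI[of S])
    fix s assume s: "s \<in> S"
    then show "fun_oplus S x y s = fun_oplus S (fun_odot S x (fun_oplus S y (\<lambda>s\<in>S. 1)))
        (fun_odot S (fun_oplus S x (\<lambda>s\<in>S. 1)) y) s"
      using b[OF s] by (simp add: min_def max_def)
  qed simp
next
  fix x assume m: "x \<in> Q"
  show "fun_odot S x x = x" "fun_odot S x (\<lambda>s\<in>S. 0) = (\<lambda>s\<in>S. 0)" "fun_odot S x (\<lambda>s\<in>S. 1) = x"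
    using m by (auto intro!: fun_eqI[of S] simp: mem_ge_0 mem_le_1)
qed (simp_all add: zero_mem one_mem)

lemma compl_mem:
  assumes "p \<in> Q" shows "(\<lambda>s\<in>S. 1 - p s) \<in> Q"
proof -
  have "(\<lambda>s\<in>S. 1 - p s) = fun_oplus S (\<lambda>s\<in>S. 1) p"
    using assms by (intro fun_eqI[of S]) (auto simp: mem_le_1 max_absorb1 min_absorb2)
  then show ?thesis using assms by (simp add: oplus_mem one_mem)
qed

lemma GFE_fun_algebra: "GFE S Q"
proof -
  have "(\<lambda>s\<in>S. p s + q s) \<in> Q" if m: "p \<in> Q" "q \<in> Q" and le: "\<forall>s\<in>S. p s \<le> 1 - q s" for p q
  proof -
    \<comment> \<open>The hypothesis says q \<le> 1 - p, so the inner sum is the difference (1 - p)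
      - q, whose complement is p + q.\<close>
    have "(\<lambda>s\<in>S. p s + q s) = (\<lambda>s\<in>S. 1 - fun_oplus S (\<lambda>s\<in>S. 1 - p s) q s)"
      using le by (intro fun_eqI[of S]) (force simp: max_def min_def)+
    then show ?thesis using m by (simp add: compl_mem oplus_mem)
  qed
  then show ?thesis
    unfolding GFE_def using subset_unit zero_mem one_mem compl_mem by blast
qed

text \<open>The assumption says that each p meets its complement in 0. For real t, min t (1 - t) = 0
  leaves only t = 0 and t = 1. This is the common last step in deriving two-valuedness from (R3),
  from (R4) and from the ring axioms.\<close>

lemma two_valuedI:
  assumes "\<And>p s. p \<in> Q \<Longrightarrow> s \<in> S \<Longrightarrow> min (p s) (1 - p s) = 0"
  shows "Q \<subseteq> S \<rightarrow>\<^sub>E {0, 1}"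
proof
  fix p assume p: "p \<in> Q"
  show "p \<in> S \<rightarrow>\<^sub>E {0, 1}"
  proof (rule PiE_I)
    fix s assume "s \<in> S"
    from assms[OF p this] show "p s \<in> {0, 1}"
      by (auto simp: min_def split: if_splits)
  qed (use p in simp)
qed

lemma two_valued_if_R3:
  assumes "identity_R3 (fun_algebra S Q)"
  shows "Q \<subseteq> S \<rightarrow>\<^sub>E {0, 1}"
proof (rule two_valuedI)
  fix p s assume p: "p \<in> Q" and s: "s \<in> S"
  interpret identity_R3 "fun_algebra S Q" by fact
  \<comment> \<open>With y = 0 the inner factor xy + 1 is 1, and (R3) collapses to (x + 1)x =
    0.\<close>
  from R3[of p "\<lambda>s\<in>S. 0"] p zero_mem
  have "fun_odot S (fun_oplus S (fun_odot S (fun_oplus S (fun_odot S p (\<lambda>s\<in>S. 0)) (\<lambda>s\<in>S. 1)) p)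
      (\<lambda>s\<in>S. 1)) p s = fun_odot S p (\<lambda>s\<in>S. 0) s"
    by simp
  with s mem_ge_0[OF p s] mem_le_1[OF p s] show "min (p s) (1 - p s) = 0"
    by (simp add: min_def max_def split: if_splits)
qed

lemma two_valued_if_R4:
  assumes "identity_R4 (fun_algebra S Q)"
  shows "Q \<subseteq> S \<rightarrow>\<^sub>E {0, 1}"
proof (rule two_valuedI)
  fix p s assume p: "p \<in> Q" and s: "s \<in> S"
  interpret identity_R4 "fun_algebra S Q" by fact
  \<comment> \<open>With y = 1 and m = min x (1 - x), the left side is the distance between x and 1
    - x, namely 1 - 2m, while the right side is 1 - m. Hence m = 0.\<close>
  from R4[of p "\<lambda>s\<in>S. 1"] p one_mem
  have "fun_oplus S (fun_odot S p (\<lambda>s\<in>S. 1)) (fun_oplus S p (\<lambda>s\<in>S. 1)) s =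
      fun_oplus S (fun_odot S (fun_oplus S (fun_odot S p (\<lambda>s\<in>S. 1)) (\<lambda>s\<in>S. 1)) p) (\<lambda>s\<in>S. 1) s"
    by simp
  with s mem_ge_0[OF p s] mem_le_1[OF p s] show "min (p s) (1 - p s) = 0"
    by (simp add: min_def max_def split: if_splits)
qed

lemma two_valued_if_boolean_ring:
  assumes "boolean_ring (fun_algebra S Q)"
  shows "Q \<subseteq> S \<rightarrow>\<^sub>E {0, 1}"
proof (rule two_valuedI)
  fix p s assume p: "p \<in> Q" and s: "s \<in> S"
  interpret boolean_ring "fun_algebra S Q" by fact
  \<comment> \<open>Both products on the right equal p, so their sum vanishes, whereas the left side
    is min p (1 - p).\<close>
  have "fun_odot S p (fun_oplus S p (\<lambda>s\<in>S. 1)) = fun_oplus S (fun_odot S p p) (fun_odot S p (\<lambda>s\<in>S. 1))"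
    using r_distr[of p "\<lambda>s\<in>S. 1" p] p one_mem by simp
  then have "fun_odot S p (fun_oplus S p (\<lambda>s\<in>S. 1)) s =
      fun_oplus S (fun_odot S p p) (fun_odot S p (\<lambda>s\<in>S. 1)) s"
    by simp
  with s mem_ge_0[OF p s] mem_le_1[OF p s] show "min (p s) (1 - p s) = 0"
    by (simp add: min_def max_def split: if_splits)
qed

context
  assumes two_valued: "Q \<subseteq> S \<rightarrow>\<^sub>E {0, 1}"
begin

text \<open>This turns each identity below into a finite check: at a point of \<open>S\<close>, two
  arguments give four cases and three give eight.\<close>

lemma mem_0_or_1: "p \<in> Q \<Longrightarrow> s \<in> S \<Longrightarrow> p s = 0 \<or> p s = 1"
  using PiE_mem[OF subsetD[OF two_valued]] by simp

lemma R3_if_two_valued: "identity_R3 (fun_algebra S Q)"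
proof (unfold_locales; simp only: fun_algebra_simps)
  fix x y assume m: "x \<in> Q" "y \<in> Q"
  show "fun_odot S (fun_oplus S (fun_odot S (fun_oplus S (fun_odot S x y) (\<lambda>s\<in>S. 1)) x) (\<lambda>s\<in>S. 1)) x
      = fun_odot S x y"
  proof (rule fun_eqI[of S])
    fix s assume s: "s \<in> S"
    show "fun_odot S (fun_oplus S (fun_odot S (fun_oplus S (fun_odot S x y) (\<lambda>s\<in>S. 1)) x) (\<lambda>s\<in>S. 1)) x s
        = fun_odot S x y s"
      using mem_0_or_1[OF m(1) s] mem_0_or_1[OF m(2) s] s by (elim disjE) simp_all
  qed simp
qed

lemma R4_if_two_valued: "identity_R4 (fun_algebra S Q)"
proof (unfold_locales; simp only: fun_algebra_simps)
  fix x y assume m: "x \<in> Q" "y \<in> Q"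
  show "fun_oplus S (fun_odot S x y) (fun_oplus S x (\<lambda>s\<in>S. 1)) =
      fun_oplus S (fun_odot S (fun_oplus S (fun_odot S x y) (\<lambda>s\<in>S. 1)) x) (\<lambda>s\<in>S. 1)"
  proof (rule fun_eqI[of S])
    fix s assume s: "s \<in> S"
    show "fun_oplus S (fun_odot S x y) (fun_oplus S x (\<lambda>s\<in>S. 1)) s =
        fun_oplus S (fun_odot S (fun_oplus S (fun_odot S x y) (\<lambda>s\<in>S. 1)) x) (\<lambda>s\<in>S. 1) s"
      using mem_0_or_1[OF m(1) s] mem_0_or_1[OF m(2) s] s by (elim disjE) simp_all
  qed simp
qed

text \<open>On the values 0 and 1 the operations are exclusive or and conjunction, so the ring laws
  hold pointwise as in the field with two elements. Two-valuedness enters in the associativity of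
  addition and in distributivity; commutativity of addition and the laws of multiplication come from
  the near-RLSE structure.\<close>

lemma boolean_ring_if_two_valued: "boolean_ring (fun_algebra S Q)"
proof -
  interpret near_RLSE "fun_algebra S Q"
    using specific_near_RLSE_fun_algebra by (rule specific_near_RLSE.axioms)
  have "ring (fun_algebra S Q)"
  proof (intro ringI abelian_groupI monoidI; (simp only: fun_algebra_simps)?)
    fix x y z assume m: "x \<in> Q" "y \<in> Q" "z \<in> Q"
    note v = mem_0_or_1[OF m(1)] mem_0_or_1[OF m(2)] mem_0_or_1[OF m(3)]
    show "fun_oplus S (fun_oplus S x y) z = fun_oplus S x (fun_oplus S y z)"
    proof (rule fun_eqI[of S])
      fix s assume s: "s \<in> S"
      then show "(fun_oplus S (fun_oplus S x y) z) s = (fun_oplus S x (fun_oplus S y z)) s"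
        using v[OF s] by (elim disjE) simp_all
    qed simp
    show "fun_odot S (fun_oplus S x y) z = fun_oplus S (fun_odot S x z) (fun_odot S y z)"
    proof (rule fun_eqI[of S])
      fix s assume s: "s \<in> S"
      then show "(fun_odot S (fun_oplus S x y) z) s = (fun_oplus S (fun_odot S x z) (fun_odot S y z)) s"
        using v[OF s] by (elim disjE) simp_all
    qed simp
    show "fun_odot S z (fun_oplus S x y) = fun_oplus S (fun_odot S z x) (fun_odot S z y)"
    proof (rule fun_eqI[of S])
      fix s assume s: "s \<in> S"
      then show "(fun_odot S z (fun_oplus S x y)) s = (fun_oplus S (fun_odot S z x) (fun_odot S z y)) s"
        using v[OF s] by (elim disjE) simp_all
    qed simp
    show "fun_odot S (fun_odot S x y) z = fun_odot S x (fun_odot S y z)"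
      using meet_assoc[of x y z] m by simp
  next
    fix x y assume m: "x \<in> Q" "y \<in> Q"
    show "fun_oplus S x y \<in> Q" "fun_odot S x y \<in> Q"
      using m by (simp_all add: oplus_mem odot_mem)
    show "fun_oplus S x y = fun_oplus S y x"
      using R1[of x y] m by simp
  next
    fix x assume m: "x \<in> Q"
    show "fun_oplus S (\<lambda>s\<in>S. 0) x = x"
      using m by (intro fun_eqI[of S]) (auto simp: mem_ge_0)
    \<comment> \<open>Characteristic two: x serves as its own additive inverse.\<close>
    have "fun_oplus S x x = (\<lambda>s\<in>S. 0)"
      by (intro fun_eqI[of S]) auto
    then show "\<exists>y\<in>Q. fun_oplus S y x = (\<lambda>s\<in>S. 0)"
      using m by blast
    show "fun_odot S x (\<lambda>s\<in>S. 1) = x" "fun_odot S (\<lambda>s\<in>S. 1) x = x"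
      using meet_one[of x] meet_comm[of "\<lambda>s\<in>S. 1" x] m one_mem by simp_all
  qed (simp_all add: zero_mem one_mem)
  then show ?thesis
    by (rule boolean_ring.intro) (use meet_idem in \<open>simp add: boolean_ring_axioms_def\<close>)
qed

end

text \<open>Two-valuedness is the hub: comparing every other condition with it makes all five
  equivalent.\<close>

lemma two_valued_iff:
  shows "Q \<subseteq> S \<rightarrow>\<^sub>E {0, 1} \<longleftrightarrow> identity_R3 (fun_algebra S Q)"
    and "Q \<subseteq> S \<rightarrow>\<^sub>E {0, 1} \<longleftrightarrow> identity_R4 (fun_algebra S Q)"
    and "Q \<subseteq> S \<rightarrow>\<^sub>E {0, 1} \<longleftrightarrow> RLSE (fun_algebra S Q)"
    and "Q \<subseteq> S \<rightarrow>\<^sub>E {0, 1} \<longleftrightarrow> boolean_ring (fun_algebra S Q)"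
proof -
  show R3: "Q \<subseteq> S \<rightarrow>\<^sub>E {0, 1} \<longleftrightarrow> identity_R3 (fun_algebra S Q)"
    using R3_if_two_valued two_valued_if_R3 by blast
  show R4: "Q \<subseteq> S \<rightarrow>\<^sub>E {0, 1} \<longleftrightarrow> identity_R4 (fun_algebra S Q)"
    using R4_if_two_valued two_valued_if_R4 by blast
  show "Q \<subseteq> S \<rightarrow>\<^sub>E {0, 1} \<longleftrightarrow> boolean_ring (fun_algebra S Q)"
    using boolean_ring_if_two_valued two_valued_if_boolean_ring by blast
  \<comment> \<open>The near-RLSE axioms hold for every such \<open>Q\<close>, so being an RLSE
    amounts to (R3) together with (R4).\<close>
  have "near_RLSE (fun_algebra S Q)"
    using specific_near_RLSE_fun_algebra by (rule specific_near_RLSE.axioms)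
  then show "Q \<subseteq> S \<rightarrow>\<^sub>E {0, 1} \<longleftrightarrow> RLSE (fun_algebra S Q)"
    using R3 R4 by (auto simp: RLSE_def near_RLSE_def)
qed

end

theorem theorem4p8:
  fixes S :: "'a set" and Q :: "('a \<Rightarrow> real) set"
  assumes "Q \<subseteq> S \<rightarrow>\<^sub>E {0..1}"
    and "(\<lambda>s\<in>S. 0) \<in> Q" and "(\<lambda>s\<in>S. 1) \<in> Q"
    and "\<And>p q. p \<in> Q \<Longrightarrow> q \<in> Q \<Longrightarrow> fun_oplus S p q \<in> Q"
    and "\<And>p q. p \<in> Q \<Longrightarrow> q \<in> Q \<Longrightarrow> fun_odot S p q \<in> Q"
  shows "specific_near_RLSE (fun_algebra S Q) \<and>
    GFE S Q \<and>
    (Q \<subseteq> S \<rightarrow>\<^sub>E {0, 1} \<longleftrightarrow> identity_R3 (fun_algebra S Q)) \<and>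
    (Q \<subseteq> S \<rightarrow>\<^sub>E {0, 1} \<longleftrightarrow> identity_R4 (fun_algebra S Q)) \<and>
    (Q \<subseteq> S \<rightarrow>\<^sub>E {0, 1} \<longleftrightarrow> RLSE (fun_algebra S Q)) \<and>
    (Q \<subseteq> S \<rightarrow>\<^sub>E {0, 1} \<longleftrightarrow> boolean_ring (fun_algebra S Q))"
proof -
  interpret function_algebra S Q
    using assms by unfold_locales
  show ?thesis
    using specific_near_RLSE_fun_algebra GFE_fun_algebra two_valued_iff by blast
qed

end
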